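(* Let $R$ be a commutative integral domain, $\sigma\in\mathrm{Aut}(R)$, $0\ne a\in R$, and $A=R(\sigma,a)$ the corresponding generalized Weyl algebra. Let $n\ge1$ and let $\mathsf P\in\mathrm{Mat}_n(R)$ with $\det(\mathsf P)\ne0$ be such that $a\mathsf P^{-1}\in\mathrm{Mat}_n(R)$, and set $\mathsf Q:=\sigma(a\mathsf P^{-1})$. Let $V_{\mathsf P}=R^n$ as an $R$-module, and for $v\in V_{\mathsf P}$ (written as a column) define $$x\cdot v=\mathsf P\sigma^{-1}(v)\quad\text{and}\quad y\cdot v=\mathsf Q\sigma(v).$$ Under these actions, $V_{\mathsf P}$ is an $A$-module which is free of rank $n$ over $R$. Moreover, any $A$-module that is free of finite rank over $R$ is isomorphic to some $V_{\mathsf P}$.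
   Context: Modules are left and unital. The generalized Weyl algebra $R(\sigma,a)$ is the ring generated by $R$, $x$, $y$ subject to $x\sigma(r)=rx$, $yr=\sigma(r)y$ for all $r\in R$, $xy=a$, $yx=\sigma(a)$. $\mathsf P^{-1}$ is the inverse over the field of fractions of $R$. The automorphism $\sigma$ (and its inverse) is applied entrywise to matrices and column vectors over $R$. *)

theory Defs
  imports
    "HOL-Algebra.QuotRing"
    "HOL-Library.Poly_Mapping"
    "HOL-Computational_Algebra.Fraction_Field"
    "Jordan_Normal_Form.Gauss_Jordan_Elimination"
    "Jordan_Normal_Form.VS_Connect"
begin

subsection \<open>Left modules over a not necessarily commutative ring\<close>

text \<open>The axioms are those of \<^locale>\<open>module\<close> in HOL-Algebra, which requires a commutative ring.\<close>

locale left_module = A?: ring A + M?: abelian_group M 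
    for A :: "('a, 'c) ring_scheme" (structure)
      and M :: "('a, 'm, 'd) module_scheme" (structure) +
  assumes smult_closed:
      "\<lbrakk>r \<in> carrier A; v \<in> carrier M\<rbrakk> \<Longrightarrow> r \<odot>\<^bsub>M\<^esub> v \<in> carrier M"
    and smult_l_distr:
      "\<lbrakk>r \<in> carrier A; s \<in> carrier A; v \<in> carrier M\<rbrakk> \<Longrightarrow>
        (r \<oplus>\<^bsub>A\<^esub> s) \<odot>\<^bsub>M\<^esub> v = r \<odot>\<^bsub>M\<^esub> v \<oplus>\<^bsub>M\<^esub> s \<odot>\<^bsub>M\<^esub> v"
    and smult_r_distr:
      "\<lbrakk>r \<in> carrier A; v \<in> carrier M; w \<in> carrier M\<rbrakk> \<Longrightarrow>
        r \<odot>\<^bsub>M\<^esub> (v \<oplus>\<^bsub>M\<^esub> w) = r \<odot>\<^bsub>M\<^esub> v \<oplus>\<^bsub>M\<^esub> r \<odot>\<^bsub>M\<^esub> w"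
    and smult_assoc:
      "\<lbrakk>r \<in> carrier A; s \<in> carrier A; v \<in> carrier M\<rbrakk> \<Longrightarrow>
        (r \<otimes>\<^bsub>A\<^esub> s) \<odot>\<^bsub>M\<^esub> v = r \<odot>\<^bsub>M\<^esub> (s \<odot>\<^bsub>M\<^esub> v)"
    and smult_one:
      "v \<in> carrier M \<Longrightarrow> \<one>\<^bsub>A\<^esub> \<odot>\<^bsub>M\<^esub> v = v"

definition module_isomorphic ::
    "('a, 'c) ring_scheme \<Rightarrow> ('a, 'm, 'd) module_scheme \<Rightarrow> ('a, 'n, 'e) module_scheme \<Rightarrow> bool" where
  "module_isomorphic A M N \<longleftrightarrow>
     (\<exists>f \<in> LinearCombinations.module_hom A M N. bij_betw f (carrier M) (carrier N))"

definition free_of_rank :: "('r :: comm_ring_1, 'm) module \<Rightarrow> nat \<Rightarrow> bool" where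
  "free_of_rank V n \<longleftrightarrow> Module.module class_ring V \<and>
     (\<exists>B. B \<subseteq> carrier V \<and> finite B \<and> card B = n \<and>
        \<not> LinearCombinations.module.lin_dep class_ring V B \<and> LinearCombinations.module.span class_ring V B = carrier V)"

subsection \<open>Generalized Weyl algebras\<close>

text \<open>The free monoid on an alphabet, written additively because the convolution product of
  \<^type>\<open>poly_mapping\<close> is built on an additive monoid of exponents.\<close>

datatype 'g free_word = Word (letters: "'g list")

instantiation free_word :: (type) monoid_add
begin
definition zero_free_word :: "'g free_word" where
  "zero_free_word = Word []"
definition plus_free_word :: "'g free_word \<Rightarrow> 'g free_word \<Rightarrow> 'g free_word" where
  "plus_free_word u v = Word (letters u @ letters v)"
instance
  by standard (auto simp: zero_free_word_def plus_free_word_def)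
end

datatype 'r gwa_gen = Scalar 'r | X | Y

text \<open>The free associative unital ring (with integer coefficients) on one generator for each
  element of \<open>R\<close> and the two generators \<open>x\<close>, \<open>y\<close>.\<close>

type_synonym 'r gwa_free = "'r gwa_gen free_word \<Rightarrow>\<^sub>0 int"

definition gen :: "'r gwa_gen \<Rightarrow> 'r gwa_free" where
  "gen g = Poly_Mapping.single (Word [g]) 1"

text \<open>The first three families make \<open>R\<close> map to the quotient by a unital ring homomorphism; the
  remaining ones are the defining relations of \<open>R(\<sigma>, a)\<close>.\<close>

definition gwa_relations :: "('r :: comm_ring_1 \<Rightarrow> 'r) \<Rightarrow> 'r \<Rightarrow> 'r gwa_free set" where
  "gwa_relations \<sigma> a =
     {gen (Scalar (r + s)) - (gen (Scalar r) + gen (Scalar s)) | r s. True}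
   \<union> {gen (Scalar (r * s)) - gen (Scalar r) * gen (Scalar s) | r s. True}
   \<union> {gen (Scalar 1) - 1}
   \<union> {gen X * gen (Scalar (\<sigma> r)) - gen (Scalar r) * gen X | r. True}
   \<union> {gen Y * gen (Scalar r) - gen (Scalar (\<sigma> r)) * gen Y | r. True}
   \<union> {gen X * gen Y - gen (Scalar a)}
   \<union> {gen Y * gen X - gen (Scalar (\<sigma> a))}"

definition gwa_ideal :: "('r :: comm_ring_1 \<Rightarrow> 'r) \<Rightarrow> 'r \<Rightarrow> 'r gwa_free set" where
  "gwa_ideal \<sigma> a = Idl\<^bsub>class_ring\<^esub> (gwa_relations \<sigma> a)"

definition gwa :: "('r :: comm_ring_1 \<Rightarrow> 'r) \<Rightarrow> 'r \<Rightarrow> 'r gwa_free set ring" where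
  "gwa \<sigma> a = class_ring Quot gwa_ideal \<sigma> a"

definition gwa_elem :: "('r :: comm_ring_1 \<Rightarrow> 'r) \<Rightarrow> 'r \<Rightarrow> 'r gwa_gen \<Rightarrow> 'r gwa_free set" where
  "gwa_elem \<sigma> a g = gwa_ideal \<sigma> a +>\<^bsub>class_ring\<^esub> gen g"

lemma ideal_gwa_ideal: "ideal (gwa_ideal \<sigma> a) class_ring"
  unfolding gwa_ideal_def by (rule ring.genideal_ideal) (unfold_locales, auto)

lemma ring_gwa: "ring (gwa \<sigma> a)"
  unfolding gwa_def by (rule ideal.quotient_is_ring[OF ideal_gwa_ideal])

lemma gwa_elem_in_carrier: "gwa_elem \<sigma> a g \<in> carrier (gwa \<sigma> a)"
  by (auto simp: gwa_elem_def gwa_def FactRing_def A_RCOSETS_def' a_r_coset_def')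

text \<open>An \<open>A\<close>-module regarded as an \<open>R\<close>-module along \<open>R \<rightarrow> A\<close>.\<close>

definition restrict_scalars ::
    "('r :: comm_ring_1 \<Rightarrow> 'r) \<Rightarrow> 'r \<Rightarrow> ('r gwa_free set, 'm) module \<Rightarrow> ('r, 'm) module" where
  "restrict_scalars \<sigma> a M =
     \<lparr>carrier = carrier M, mult = mult M, one = one M, zero = zero M, add = add M,
      smult = (\<lambda>r v. gwa_elem \<sigma> a (Scalar r) \<odot>\<^bsub>M\<^esub> v)\<rparr>"

subsection \<open>The modules \<open>V\<^sub>P\<close>\<close>

text \<open>The matrix \<open>a P\<^sup>-\<^sup>1\<close> over the field of fractions. The library function \<^const>\<open>mat_inverse\<close>
  returns \<^const>\<open>None\<close> only for singular matrices.\<close>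

definition scaled_inverse :: "'r :: idom \<Rightarrow> 'r mat \<Rightarrow> 'r fract mat" where
  "scaled_inverse a P = to_fract a \<cdot>\<^sub>m the (mat_inverse (map_mat to_fract P))"

definition admissible :: "'r :: idom \<Rightarrow> nat \<Rightarrow> 'r mat \<Rightarrow> bool" where
  "admissible a n P \<longleftrightarrow> P \<in> carrier_mat n n \<and> det P \<noteq> 0 \<and>
     elements_mat (scaled_inverse a P) \<subseteq> range to_fract"

text \<open>\<open>Q = \<sigma>(a P\<^sup>-\<^sup>1)\<close>, where the entries of \<open>a P\<^sup>-\<^sup>1\<close> are pulled back along the embedding of \<open>R\<close> into
  its field of fractions; this is meaningful only for admissible \<open>P\<close>.\<close>

definition Q_mat :: "('r :: idom \<Rightarrow> 'r) \<Rightarrow> 'r \<Rightarrow> 'r mat \<Rightarrow> 'r mat" where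
  "Q_mat \<sigma> a P = map_mat \<sigma> (map_mat (inv_into UNIV to_fract) (scaled_inverse a P))"

text \<open>\<open>V\<close> is an \<open>A\<close>-module whose underlying \<open>R\<close>-module is \<open>R\<^sup>n\<close> and on which \<open>x\<close> and \<open>y\<close> act by the
  prescribed formulas. Since \<open>A\<close> is generated by \<open>R\<close>, \<open>x\<close> and \<open>y\<close>, this describes the action
  of all of \<open>A\<close>; that such a \<open>V\<close> exists is the content of "\<open>V\<^sub>P\<close> is an \<open>A\<close>-module".\<close>

definition is_V ::
    "('r :: idom \<Rightarrow> 'r) \<Rightarrow> 'r \<Rightarrow> nat \<Rightarrow> 'r mat \<Rightarrow> ('r gwa_free set, 'r vec) module \<Rightarrow> bool" where
  "is_V \<sigma> a n P V \<longleftrightarrow> left_module (gwa \<sigma> a) V \<and>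
     carrier V = carrier_vec n \<and> zero V = 0\<^sub>v n \<and>
     (\<forall>v \<in> carrier_vec n. \<forall>w \<in> carrier_vec n. v \<oplus>\<^bsub>V\<^esub> w = v + w) \<and>
     (\<forall>r. \<forall>v \<in> carrier_vec n. gwa_elem \<sigma> a (Scalar r) \<odot>\<^bsub>V\<^esub> v = r \<cdot>\<^sub>v v) \<and>
     (\<forall>v \<in> carrier_vec n. gwa_elem \<sigma> a X \<odot>\<^bsub>V\<^esub> v = P *\<^sub>v map_vec (inv_into UNIV \<sigma>) v) \<and>
     (\<forall>v \<in> carrier_vec n. gwa_elem \<sigma> a Y \<odot>\<^bsub>V\<^esub> v = Q_mat \<sigma> a P *\<^sub>v map_vec \<sigma> v)"

end

(* A module over A that is free over R is R^n with semilinear operators x and y, hence given by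
   matrices P and Q' through v |-> P sigma^-1(v) and v |-> Q' sigma(v). Writing Q' = sigma(Q), the
   relation xy = a says P Q = a, so that det P is nonzero and Q = a P^-1 has entries in R.
   Conversely P Q = a forces Q P = a over the field of fractions, so both relations xy = a and
   yx = sigma(a) hold for these operators, and the action of the free ring on R^n that they
   define kills the ideal of relations. *)
theory Submission
  imports Defs
begin

subsection \<open>The quotient map onto the algebra\<close>

text \<open>No normal form and no basis of \<open>gwa\<close> is ever used: the algebra is known
  only as a quotient of a free ring by a generated ideal. This leaves two ways to reach all of its
  elements. An action is built on the free ring, with integer coefficients since x and y act only
  semilinearly over R, and it descends because an annihilator is a two-sided ideal. An equation
  between actions is checked on generators and carried to every element by induction over the free
  ring; this is also how a module is pinned down by \<open>is_V\<close>, which prescribes generators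
  only. The other obstacle is that a P^-1 is formed over the field of fractions and pulled back
  entrywise. An equation over R between P and a second matrix replaces it wherever operators occur;
  the field of fractions returns only to translate between the two forms and to swap the
  factors.\<close>

definition class_map :: "('r :: comm_ring_1 \<Rightarrow> 'r) \<Rightarrow> 'r \<Rightarrow> 'r gwa_free \<Rightarrow> 'r gwa_free set" where
  "class_map \<sigma> a f = gwa_ideal \<sigma> a +>\<^bsub>class_ring\<^esub> f"

lemma gwa_elem_eq_class_map: "gwa_elem \<sigma> a g = class_map \<sigma> a (gen g)"
  by (simp add: gwa_elem_def class_map_def)

lemma class_map_ring_hom: "class_map \<sigma> a \<in> Ring.ring_hom class_ring (gwa \<sigma> a)"
  using ideal.rcos_ring_hom[OF ideal_gwa_ideal[of \<sigma> a]]
  unfolding gwa_def class_map_def[abs_def] by simp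

lemma class_map_hom:
  "class_map \<sigma> a f \<in> carrier (gwa \<sigma> a)"
  "class_map \<sigma> a (f + g) = class_map \<sigma> a f \<oplus>\<^bsub>gwa \<sigma> a\<^esub> class_map \<sigma> a g"
  "class_map \<sigma> a (f * g) = class_map \<sigma> a f \<otimes>\<^bsub>gwa \<sigma> a\<^esub> class_map \<sigma> a g"
  "class_map \<sigma> a 1 = \<one>\<^bsub>gwa \<sigma> a\<^esub>"
  using class_map_ring_hom[of \<sigma> a] by (auto simp: Ring.ring_hom_def)

lemma class_map_surj:
  assumes "c \<in> carrier (gwa \<sigma> a)"
  obtains f where "c = class_map \<sigma> a f"
  using assms by (auto simp: gwa_def FactRing_def A_RCOSETS_def' class_map_def)

lemma mem_class_map: "g \<in> class_map \<sigma> a f \<longleftrightarrow> g - f \<in> gwa_ideal \<sigma> a"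
  by (auto simp: class_map_def a_r_coset_def' intro: bexI[of _ "g - f"])

lemma class_map_eq:
  assumes "f - g \<in> gwa_ideal \<sigma> a"
  shows "class_map \<sigma> a f = class_map \<sigma> a g"
proof -
  interpret I: ideal "gwa_ideal \<sigma> a" class_ring by (rule ideal_gwa_ideal)
  show ?thesis
    using I.a_repr_independence'[of f g] assms mem_class_map[of f \<sigma> a g]
    by (simp add: class_map_def)
qed

lemma class_map_relation:
  assumes "f - g \<in> gwa_relations \<sigma> a"
  shows "class_map \<sigma> a f = class_map \<sigma> a g"
proof -
  show ?thesis
    using ring.genideal_self[OF class_ring.ring_axioms, of "gwa_relations \<sigma> a"] assms
    by (intro class_map_eq) (auto simp: gwa_ideal_def)
qed

lemma gwa_elem_relations:
  "gwa_elem \<sigma> a (Scalar (r + s)) = gwa_elem \<sigma> a (Scalar r) \<oplus>\<^bsub>gwa \<sigma> a\<^esub> gwa_elem \<sigma> a (Scalar s)"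
  "gwa_elem \<sigma> a (Scalar (r * s)) = gwa_elem \<sigma> a (Scalar r) \<otimes>\<^bsub>gwa \<sigma> a\<^esub> gwa_elem \<sigma> a (Scalar s)"
  "gwa_elem \<sigma> a (Scalar 1) = \<one>\<^bsub>gwa \<sigma> a\<^esub>"
  "gwa_elem \<sigma> a X \<otimes>\<^bsub>gwa \<sigma> a\<^esub> gwa_elem \<sigma> a (Scalar (\<sigma> r)) = gwa_elem \<sigma> a (Scalar r) \<otimes>\<^bsub>gwa \<sigma> a\<^esub> gwa_elem \<sigma> a X"
  "gwa_elem \<sigma> a Y \<otimes>\<^bsub>gwa \<sigma> a\<^esub> gwa_elem \<sigma> a (Scalar r) = gwa_elem \<sigma> a (Scalar (\<sigma> r)) \<otimes>\<^bsub>gwa \<sigma> a\<^esub> gwa_elem \<sigma> a Y"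
  "gwa_elem \<sigma> a X \<otimes>\<^bsub>gwa \<sigma> a\<^esub> gwa_elem \<sigma> a Y = gwa_elem \<sigma> a (Scalar a)"
  "gwa_elem \<sigma> a Y \<otimes>\<^bsub>gwa \<sigma> a\<^esub> gwa_elem \<sigma> a X = gwa_elem \<sigma> a (Scalar (\<sigma> a))"
  \<comment> \<open>Read from right to left, the homomorphism equations turn both sides into classes
    of elements of the free ring whose difference is literally one of the generators of the
    ideal.\<close>
  unfolding gwa_elem_eq_class_map class_map_hom(2-4)[symmetric]
  by (rule class_map_relation; auto simp: gwa_relations_def)+

section \<open>Induction over the free ring and linearity checked on generators\<close>

lemma single_Word_Cons:
  "Poly_Mapping.single (Word (g # l)) (1::int) = gen g * Poly_Mapping.single (Word l) 1"
  by (simp add: gen_def Poly_Mapping.mult_single plus_free_word_def)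

lemma single_Word_Nil: "Poly_Mapping.single (Word []) (1::int) = 1"
  by (metis single_one zero_free_word_def)

text \<open>The words form a basis of a free abelian group, and closure under differences alone
  already covers sums, negatives and integer multiples.\<close>

lemma poly_mapping_diff_induct [case_names single diff]:
  fixes f :: "'w \<Rightarrow>\<^sub>0 int"
  assumes single: "\<And>w. P (Poly_Mapping.single w 1)" and diff: "\<And>f g. P f \<Longrightarrow> P g \<Longrightarrow> P (f - g)"
  shows "P f"
proof (rule frag_induction[OF subset_UNIV, where P = P])
  show "P 0"
    \<comment> \<open>Types are inhabited, so some basis element exists, and 0 is its difference
      with itself.\<close>
    using diff[OF single[of undefined] single[of undefined]] by simp
qed (rule single diff, assumption?)+

lemma gwa_free_induct [case_names gen one diff mult]:
  fixes f :: "'r gwa_free"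
  assumes gen: "\<And>g. P (gen g)" and one: "P 1"
    and diff: "\<And>f g. P f \<Longrightarrow> P g \<Longrightarrow> P (f - g)"
    and mult: "\<And>f g. P f \<Longrightarrow> P g \<Longrightarrow> P (f * g)"
  shows "P f"
proof (induction f rule: poly_mapping_diff_induct)
  case (single w)
  have "P (Poly_Mapping.single (Word l) 1)" for l
    by (induction l) (auto simp: single_Word_Nil single_Word_Cons intro: gen one mult)
  then show ?case
    by (cases w) simp
qed (rule diff)

text \<open>The free ring elements whose class commutes with \<open>f\<close> form a subring that
  contains the generators, hence everything. Used with the identity it compares two actions; used
  with a coordinate map it gives an isomorphism.\<close>

lemma gwa_linearI:
  assumes M: "left_module (gwa \<sigma> a) M" and N: "left_module (gwa \<sigma> a) N"
    and clo: "\<And>v. v \<in> carrier M \<Longrightarrow> f v \<in> carrier N"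
    and add: "\<And>v w. \<lbrakk>v \<in> carrier M; w \<in> carrier M\<rbrakk> \<Longrightarrow> f (v \<oplus>\<^bsub>M\<^esub> w) = f v \<oplus>\<^bsub>N\<^esub> f w"
    and gen: "\<And>g v. v \<in> carrier M \<Longrightarrow> f (gwa_elem \<sigma> a g \<odot>\<^bsub>M\<^esub> v) = gwa_elem \<sigma> a g \<odot>\<^bsub>N\<^esub> f v"
    and c: "c \<in> carrier (gwa \<sigma> a)" and v: "v \<in> carrier M"
  shows "f (c \<odot>\<^bsub>M\<^esub> v) = c \<odot>\<^bsub>N\<^esub> f v"
proof -
  interpret M: left_module "gwa \<sigma> a" M by (rule M)
  interpret N: left_module "gwa \<sigma> a" N by (rule N)
  obtain p where p: "c = class_map \<sigma> a p" using c class_map_surj by blast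
  have "\<forall>v \<in> carrier M. f (class_map \<sigma> a p \<odot>\<^bsub>M\<^esub> v) = class_map \<sigma> a p \<odot>\<^bsub>N\<^esub> f v"
  proof (induction p rule: gwa_free_induct)
    case (gen g)
    then show ?case using assms(5) by (simp add: gwa_elem_eq_class_map)
  next
    case one
    then show ?case by (simp add: class_map_hom M.smult_one N.smult_one clo)
  next
    case (diff p q)
    show ?case
    proof
      fix v assume v: "v \<in> carrier M"
      \<comment> \<open>The difference is handled without subtraction: p = (p - q) + q is expanded
        on both sides, and the term of q is cancelled in \<open>N\<close>.\<close>
      have *: "class_map \<sigma> a p = class_map \<sigma> a (p - q) \<oplus>\<^bsub>gwa \<sigma> a\<^esub> class_map \<sigma> a q"
        unfolding class_map_hom(2)[symmetric] by simp
      have "f (class_map \<sigma> a p \<odot>\<^bsub>M\<^esub> v) =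
          f (class_map \<sigma> a (p - q) \<odot>\<^bsub>M\<^esub> v) \<oplus>\<^bsub>N\<^esub> f (class_map \<sigma> a q \<odot>\<^bsub>M\<^esub> v)"
        unfolding * using v by (simp add: class_map_hom(1) M.smult_l_distr M.smult_closed add)
      moreover have "class_map \<sigma> a p \<odot>\<^bsub>N\<^esub> f v =
          class_map \<sigma> a (p - q) \<odot>\<^bsub>N\<^esub> f v \<oplus>\<^bsub>N\<^esub> class_map \<sigma> a q \<odot>\<^bsub>N\<^esub> f v"
        unfolding * using v by (simp add: class_map_hom(1) N.smult_l_distr clo)
      ultimately show "f (class_map \<sigma> a (p - q) \<odot>\<^bsub>M\<^esub> v) = class_map \<sigma> a (p - q) \<odot>\<^bsub>N\<^esub> f v"
        using diff v N.M.add.right_cancel[of "class_map \<sigma> a q \<odot>\<^bsub>N\<^esub> f v"]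
        by (simp add: class_map_hom(1) M.smult_closed N.smult_closed clo)
    qed
  next
    case (mult p q)
    then show ?case by (simp add: class_map_hom M.smult_assoc N.smult_assoc M.smult_closed clo)
  qed
  then show ?thesis using p v by blast
qed

subsection \<open>Actions of the free ring on vectors\<close>

text \<open>The Z-linear extension of a function on words. Its values are scalars because vectors of
  all lengths share one type, so that a sum of vectors has no common zero; \<open>free_act\<close>
  therefore sums coordinate by coordinate.\<close>

definition int_extension :: "('w \<Rightarrow> 'r :: comm_ring_1) \<Rightarrow> ('w \<Rightarrow>\<^sub>0 int) \<Rightarrow> 'r" where
  "int_extension c f = (\<Sum>w\<in>Poly_Mapping.keys f. of_int (Poly_Mapping.lookup f w) * c w)"

lemma int_extension_superset:
  assumes "finite S" "Poly_Mapping.keys f \<subseteq> S"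
  shows "int_extension c f = (\<Sum>w\<in>S. of_int (Poly_Mapping.lookup f w) * c w)"
  unfolding int_extension_def
  using assms by (intro sum.mono_neutral_left) (auto simp: in_keys_iff)

lemma int_extension_diff: "int_extension c (f - g) = int_extension c f - int_extension c g"
proof -
  \<comment> \<open>Cancellation may make the support of \<open>f - g\<close> smaller, so all three
    sums are taken over one common index set.\<close>
  let ?S = "Poly_Mapping.keys f \<union> Poly_Mapping.keys g"
  have "int_extension c h = (\<Sum>w\<in>?S. of_int (Poly_Mapping.lookup h w) * c w)"
    if "h \<in> {f, g, f - g}" for h
    using that keys_diff[of f g] by (intro int_extension_superset) auto
  then show ?thesis
    by (simp add: lookup_minus left_diff_distrib sum_subtractf)
qed

lemma int_extension_zero: "int_extension c 0 = 0"
  by (simp add: int_extension_def)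

lemma int_extension_single: "int_extension c (Poly_Mapping.single w 1) = c w"
  by (simp add: int_extension_def)

lemma int_extension_add_coeff:
  "int_extension (\<lambda>w. c w + d w) f = int_extension c f + int_extension d f"
  by (simp add: int_extension_def sum.distrib distrib_left)

text \<open>Additivity is all that the operators of x and y share with scalar multiplication, and it
  suffices to extend them over the integers.\<close>

locale vec_operators =
  fixes n :: nat and act :: "'g \<Rightarrow> 'r :: comm_ring_1 vec \<Rightarrow> 'r vec"
  assumes act_closed [simp]: "v \<in> carrier_vec n \<Longrightarrow> act g v \<in> carrier_vec n"
    and act_add: "\<lbrakk>v \<in> carrier_vec n; w \<in> carrier_vec n\<rbrakk> \<Longrightarrow> act g (v + w) = act g v + act g w"
begin

text \<open>\<open>foldr\<close> lets the last letter of a word act first, so that concatenation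
  becomes composition in the order of a left module.\<close>

definition free_act :: "('g free_word \<Rightarrow>\<^sub>0 int) \<Rightarrow> 'r vec \<Rightarrow> 'r vec" where
  "free_act f v = vec n (\<lambda>i. int_extension (\<lambda>w. foldr act (letters w) v $ i) f)"

lemma foldr_act_closed [simp]: "v \<in> carrier_vec n \<Longrightarrow> foldr act l v \<in> carrier_vec n"
  by (induction l) auto

lemma foldr_act_add:
  "\<lbrakk>v \<in> carrier_vec n; w \<in> carrier_vec n\<rbrakk> \<Longrightarrow> foldr act l (v + w) = foldr act l v + foldr act l w"
  by (induction l) (auto simp: act_add)

lemma free_act_closed [simp]: "free_act f v \<in> carrier_vec n"
  by (simp add: free_act_def)

lemma free_act_diff: "free_act (f - g) v = free_act f v - free_act g v"
  by (auto simp: free_act_def int_extension_diff)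

lemma free_act_zero: "free_act 0 v = 0\<^sub>v n"
  by (auto simp: free_act_def int_extension_zero)

lemma free_act_add: "free_act (f + g) v = free_act f v + free_act g v"
proof -
  \<comment> \<open>The sum is written with differences only, so that \<open>free_act_diff\<close>
    and \<open>free_act_zero\<close> settle it.\<close>
  have "free_act (f - (0 - g)) v = free_act f v + free_act g v"
    unfolding free_act_diff free_act_zero by (intro eq_vecI) (auto simp: free_act_def)
  then show ?thesis by simp
qed

lemma free_act_single:
  assumes "v \<in> carrier_vec n"
  shows "free_act (Poly_Mapping.single w 1) v = foldr act (letters w) v"
  using carrier_vecD[OF foldr_act_closed[OF assms, of "letters w"]]
  by (intro eq_vecI) (simp_all add: free_act_def int_extension_single)

lemma free_act_one: "v \<in> carrier_vec n \<Longrightarrow> free_act 1 v = v"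
  using free_act_single[of v "Word []"] by (simp add: single_Word_Nil)

lemma free_act_vec_add:
  assumes "v \<in> carrier_vec n" "w \<in> carrier_vec n"
  shows "free_act f (v + w) = free_act f v + free_act f w"
proof (intro eq_vecI)
  fix i assume "i < dim_vec (free_act f v + free_act f w)"
  then have i: "i < n" by (simp add: free_act_def)
  have "foldr act l (v + w) $ i = foldr act l v $ i + foldr act l w $ i" for l
    unfolding foldr_act_add[OF assms] using carrier_vecD[OF foldr_act_closed[OF assms(2), of l]] i
    by (intro index_add_vec) metis
  then show "free_act f (v + w) $ i = (free_act f v + free_act f w) $ i"
    using i by (simp add: free_act_def int_extension_add_coeff)
qed (simp add: free_act_def)

lemma free_act_vec_diff:
  assumes "v \<in> carrier_vec n" "w \<in> carrier_vec n"
  shows "free_act f (v - w) = free_act f v - free_act f w"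
proof -
  have *: "v - w + w = v"
    using assms by (intro eq_vecI) auto
  show ?thesis
    using free_act_vec_add[of "v - w" w f] assms unfolding *
    by (auto simp: free_act_def)
qed

text \<open>Both sides are additive in \<open>f\<close> and in \<open>g\<close>; for
  \<open>g\<close> this rests on the additivity of \<open>free_act f\<close> in the vector. So it is
  enough to take two words, where the claim is \<open>foldr\<close> over an appended list.\<close>

lemma free_act_mult:
  assumes "v \<in> carrier_vec n"
  shows "free_act (f * g) v = free_act f (free_act g v)"
proof (induction f rule: poly_mapping_diff_induct)
  case (single u)
  show ?case
  proof (induction g rule: poly_mapping_diff_induct)
    case (single w)
    then show ?case using assms
      by (simp add: Poly_Mapping.mult_single free_act_single plus_free_word_def)
  next
    case (diff g h)
    then show ?case
      by (simp add: right_diff_distrib free_act_diff free_act_vec_diff)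
  qed
next
  case (diff f h)
  then show ?case
    by (simp add: left_diff_distrib free_act_diff)
qed

lemma free_act_zero_vec: "free_act f (0\<^sub>v n) = 0\<^sub>v n"
  using free_act_vec_diff[of "0\<^sub>v n" "0\<^sub>v n" f] minus_cancel_vec[OF free_act_closed] by simp

text \<open>Left multiples annihilate because every element sends 0 to 0. Right multiples do because
  all vectors are annihilated, in particular those of the form g v.\<close>

lemma free_act_annihilator_ideal:
  "ideal {f. \<forall>v \<in> carrier_vec n. free_act f v = 0\<^sub>v n} class_ring"
proof (rule idealI)
  show "ring (class_ring :: ('g free_word \<Rightarrow>\<^sub>0 int) ring)" by (rule class_ring.ring_axioms)
  have grp: "group (add_monoid (class_ring :: ('g free_word \<Rightarrow>\<^sub>0 int) ring))"
    by (rule abelian_group.a_group[OF ring.is_abelian_group[OF class_ring.ring_axioms]])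
  show "subgroup {f. \<forall>v\<in>carrier_vec n. free_act f v = 0\<^sub>v n} (add_monoid class_ring)"
  proof (rule group.subgroupI[OF grp])
    fix f assume f: "f \<in> {f. \<forall>v\<in>carrier_vec n. free_act f v = 0\<^sub>v n}"
    have "inv\<^bsub>add_monoid class_ring\<^esub> f = 0 - f"
      by (rule group.inv_equality[OF grp]) auto
    then show "inv\<^bsub>add_monoid class_ring\<^esub> f \<in> {f. \<forall>v\<in>carrier_vec n. free_act f v = 0\<^sub>v n}"
      \<comment> \<open>\<open>diff_0\<close> would rewrite \<open>0 - f\<close> to
        \<open>- f\<close> and put it out of reach of \<open>free_act_diff\<close>.\<close>
      using f by (simp add: free_act_diff free_act_zero del: diff_0)
  qed (auto simp: free_act_zero free_act_add intro!: exI[of _ 0])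
qed (auto simp: free_act_mult free_act_zero_vec)

end

section \<open>From operators that satisfy the relations to a module over the algebra\<close>

locale gwa_vec_action = vec_operators n act
  for n and act :: "'r gwa_gen \<Rightarrow> 'r :: comm_ring_1 vec \<Rightarrow> 'r vec" +
  fixes \<sigma> :: "'r \<Rightarrow> 'r" and a :: 'r
  assumes act_relations:
    "v \<in> carrier_vec n \<Longrightarrow> act (Scalar r) v = r \<cdot>\<^sub>v v"
    "v \<in> carrier_vec n \<Longrightarrow> act X (\<sigma> r \<cdot>\<^sub>v v) = r \<cdot>\<^sub>v act X v"
    "v \<in> carrier_vec n \<Longrightarrow> act Y (r \<cdot>\<^sub>v v) = \<sigma> r \<cdot>\<^sub>v act Y v"
    "v \<in> carrier_vec n \<Longrightarrow> act X (act Y v) = a \<cdot>\<^sub>v v"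
    "v \<in> carrier_vec n \<Longrightarrow> act Y (act X v) = \<sigma> a \<cdot>\<^sub>v v"
begin

lemma free_act_gen: "v \<in> carrier_vec n \<Longrightarrow> free_act (gen g) v = act g v"
  by (simp add: gen_def free_act_single)

text \<open>The annihilator of R^n is an ideal that contains the relations, and
  \<open>gwa_ideal\<close> is the least such ideal.\<close>

lemma free_act_gwa_ideal:
  assumes "f \<in> gwa_ideal \<sigma> a" "v \<in> carrier_vec n"
  shows "free_act f v = 0\<^sub>v n"
proof -
  have "gwa_relations \<sigma> a \<subseteq> {f. \<forall>v \<in> carrier_vec n. free_act f v = 0\<^sub>v n}"
    by (auto simp: gwa_relations_def free_act_diff free_act_add free_act_mult free_act_one
        free_act_gen act_relations add_smult_distrib_vec smult_smult_assoc)
  then have "gwa_ideal \<sigma> a \<subseteq> {f. \<forall>v \<in> carrier_vec n. free_act f v = 0\<^sub>v n}"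
    unfolding gwa_ideal_def
    by (intro ring.genideal_minimal[OF class_ring.ring_axioms] free_act_annihilator_ideal)
  then show ?thesis using assms by auto
qed

text \<open>A coset acts through a representative picked by \<open>SOME\<close>;
  \<open>smult_class_map\<close> shows that the choice does not matter.\<close>

definition vec_gwa_module :: "('r gwa_free set, 'r vec) module" where
  "vec_gwa_module = \<lparr>carrier = carrier_vec n, mult = undefined, one = undefined, zero = 0\<^sub>v n,
     add = (+), smult = (\<lambda>c. free_act (SOME f. f \<in> c))\<rparr>"

lemma vec_gwa_module_simps:
  "carrier vec_gwa_module = carrier_vec n" "zero vec_gwa_module = 0\<^sub>v n" "add vec_gwa_module = (+)"
  by (simp_all add: vec_gwa_module_def)

lemma smult_class_map:
  assumes "v \<in> carrier_vec n"
  shows "class_map \<sigma> a f \<odot>\<^bsub>vec_gwa_module\<^esub> v = free_act f v"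
proof -
  define g where "g = (SOME g. g \<in> class_map \<sigma> a f)"
  \<comment> \<open>This puts \<open>f\<close> into its own coset, which is thus nonempty, so that
    \<open>SOME\<close> really picks a member.\<close>
  have "0 \<in> gwa_ideal \<sigma> a"
    using additive_subgroup.zero_closed[OF ideal.axioms(1)[OF ideal_gwa_ideal[of \<sigma> a]]] by simp
  then have "f \<in> class_map \<sigma> a f"
    unfolding mem_class_map by (metis diff_self)
  then have "g \<in> class_map \<sigma> a f"
    unfolding g_def by (rule someI)
  then have "free_act (g - f) v = 0\<^sub>v n"
    using assms unfolding mem_class_map by (rule free_act_gwa_ideal)
  then have "free_act g v = free_act f v"
    using free_act_add[of "g - f" f v] left_zero_vec[OF free_act_closed[of f v]] by simp
  then show ?thesis
    by (simp add: vec_gwa_module_def g_def)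
qed

lemma left_module_vec_gwa_module: "left_module (gwa \<sigma> a) vec_gwa_module"
proof -
  have grp: "abelian_group vec_gwa_module"
    by (rule abelian_groupI)
      (auto simp: vec_gwa_module_simps intro!: bexI[of _ "- _"] )
  show ?thesis
    unfolding left_module_def left_module_axioms_def
    \<comment> \<open>Each element of the algebra is replaced by the class of a free ring element,
      which turns the module axioms into the laws of \<open>free_act\<close>.\<close>
    by (intro conjI ring_gwa grp allI impI;
        (elim class_map_surj)?; (elim class_map_surj)?;
        simp add: vec_gwa_module_simps smult_class_map class_map_hom(2-4)[symmetric]
          free_act_add free_act_vec_add free_act_mult free_act_one)
qed

lemma smult_gwa_elem:
  "v \<in> carrier_vec n \<Longrightarrow> gwa_elem \<sigma> a g \<odot>\<^bsub>vec_gwa_module\<^esub> v = act g v"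
  by (simp add: gwa_elem_eq_class_map smult_class_map free_act_gen)

end

lemma (in semiring_hom) map_mat_smult: "map_mat hom (r \<cdot>\<^sub>m A) = hom r \<cdot>\<^sub>m map_mat hom A"
  by (auto simp: hom_mult)

subsection \<open>Matrices with \<open>P Q = a\<close>\<close>

lemma (in semiring_hom) map_vec_add:
  assumes "v \<in> carrier_vec n" "w \<in> carrier_vec n"
  shows "map_vec hom (v + w) = map_vec hom v + map_vec hom w"
  using assms by (intro eq_vecI) (auto simp: hom_add)

lemma mult_mat_smult_vec:
  fixes A :: "'r :: comm_semiring_0 mat"
  assumes "A \<in> carrier_mat m n" "v \<in> carrier_vec n"
  shows "A *\<^sub>v (r \<cdot>\<^sub>v v) = r \<cdot>\<^sub>v (A *\<^sub>v v)"
  using assms by (intro eq_vecI) (auto simp: scalar_prod_smult_distrib[of _ n])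

lemma to_fract_inj_ring_hom: "inj_comm_ring_hom (to_fract :: 'r :: idom \<Rightarrow> 'r fract)"
  by unfold_locales auto

text \<open>Trades the condition over the field of fractions for an equation over R. The entries of
  a P^-1 are pulled back to R, and the product is checked after embedding, which is injective on
  matrices.\<close>

lemma admissible_factor:
  fixes a :: "'r :: idom"
  assumes "admissible a n P"
  obtains Q where "Q \<in> carrier_mat n n" "P * Q = a \<cdot>\<^sub>m 1\<^sub>m n"
proof -
  interpret F: inj_comm_ring_hom "to_fract :: 'r \<Rightarrow> 'r fract" by (rule to_fract_inj_ring_hom)
  have P: "P \<in> carrier_mat n n" and det: "det P \<noteq> 0"
    and range: "elements_mat (scaled_inverse a P) \<subseteq> range to_fract"
    using assms by (auto simp: admissible_def)
  let ?P = "map_mat to_fract P"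
  have P': "?P \<in> carrier_mat n n" using P by simp
  have "det ?P \<noteq> 0" using det F.hom_det[of P] by simp
  then have "?P \<in> Units (ring_mat TYPE('r fract) n undefined)"
    by (rule det_non_zero_imp_unit[OF P'])
  then obtain B where B: "mat_inverse ?P = Some B"
    using mat_inverse(1)[OF P'] by (metis not_None_eq)
  have inv: "?P * B = 1\<^sub>m n" "B \<in> carrier_mat n n"
    using mat_inverse(2)[OF P' B] by auto
  let ?S = "scaled_inverse a P"
  have S: "?S = to_fract a \<cdot>\<^sub>m B" "?S \<in> carrier_mat n n"
    using inv by (auto simp: scaled_inverse_def B)
  define Q where "Q = map_mat (inv_into UNIV to_fract) ?S"
  have Q: "Q \<in> carrier_mat n n" using S by (simp add: Q_def)
  \<comment> \<open>\<open>inv_into\<close> is a genuine preimage only on the range of the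
    embedding; admissibility puts every entry there.\<close>
  have QS: "map_mat to_fract Q = ?S"
  proof (rule eq_matI)
    fix i j assume ij: "i < dim_row ?S" "j < dim_col ?S"
    then have "?S $$ (i, j) \<in> range to_fract"
      using range elements_matI[OF S(2), of i j] S(2) by auto
    then show "map_mat to_fract Q $$ (i, j) = ?S $$ (i, j)"
      using ij by (simp add: Q_def f_inv_into_f)
  qed (simp_all add: Q_def)
  have "map_mat to_fract (P * Q) = ?P * ?S"
    using P Q by (simp add: F.mat_hom_mult QS)
  also have "\<dots> = map_mat to_fract (a \<cdot>\<^sub>m 1\<^sub>m n)"
    using P' inv S by (simp add: mult_smult_distrib F.map_mat_smult F.mat_hom_one)
  finally have "P * Q = a \<cdot>\<^sub>m 1\<^sub>m n" by (rule F.mat_hom_inj)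
  with Q show ?thesis by (rule that)
qed

text \<open>Taking determinants gives det P det Q = a^n, which is nonzero in a domain. Multiplying P
  Q = a by P^-1 from the left then identifies the scaled inverse with the embedded
  \<open>Q\<close>.\<close>

lemma factor_admissible:
  fixes a :: "'r :: idom"
  assumes P: "P \<in> carrier_mat n n" and Q: "Q \<in> carrier_mat n n"
    and PQ: "P * Q = a \<cdot>\<^sub>m 1\<^sub>m n" and a: "a \<noteq> 0"
  shows "admissible a n P" "Q_mat \<sigma> a P = map_mat \<sigma> Q"
proof -
  interpret F: inj_comm_ring_hom "to_fract :: 'r \<Rightarrow> 'r fract" by (rule to_fract_inj_ring_hom)
  let ?P = "map_mat to_fract P" and ?Q = "map_mat to_fract Q"
  have P': "?P \<in> carrier_mat n n" and Q': "?Q \<in> carrier_mat n n" using P Q by simp_all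
  have "det P * det Q = a ^ n"
    using det_mult[OF P Q] by (simp add: PQ det_smult)
  then have det: "det P \<noteq> 0" using a by auto
  have "det ?P \<noteq> 0" using det F.hom_det[of P] by simp
  then have "?P \<in> Units (ring_mat TYPE('r fract) n undefined)"
    by (rule det_non_zero_imp_unit[OF P'])
  then obtain B where B: "mat_inverse ?P = Some B"
    using mat_inverse(1)[OF P'] by (metis not_None_eq)
  have inv: "B * ?P = 1\<^sub>m n" "B \<in> carrier_mat n n"
    using mat_inverse(2)[OF P' B] by auto
  have "?P * ?Q = to_fract a \<cdot>\<^sub>m 1\<^sub>m n"
    using P Q by (simp add: F.mat_hom_mult[symmetric] PQ F.map_mat_smult F.mat_hom_one)
  then have "B * (?P * ?Q) = to_fract a \<cdot>\<^sub>m B"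
    using inv by (simp add: mult_smult_distrib[of _ n n _ n])
  moreover have "B * (?P * ?Q) = ?Q"
    using assoc_mult_mat[OF inv(2) P' Q'] left_mult_one_mat[OF Q'] by (simp add: inv(1))
  ultimately have S: "scaled_inverse a P = ?Q"
    by (simp add: scaled_inverse_def B)
  show "admissible a n P"
    using P det by (auto simp: admissible_def S elements_mat_def)
  show "Q_mat \<sigma> a P = map_mat \<sigma> Q"
    unfolding Q_mat_def S by (intro eq_matI) (auto simp: inv_into_f_f inj_on_def)
qed

text \<open>After division by \<open>a\<close>, the matrix \<open>Q\<close> is a right inverse of
  \<open>P\<close>, and a right inverse of a square matrix over a field is also a left
  inverse.\<close>

lemma factor_commute:
  fixes a :: "'r :: idom"
  assumes P: "P \<in> carrier_mat n n" and Q: "Q \<in> carrier_mat n n"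
    and PQ: "P * Q = a \<cdot>\<^sub>m 1\<^sub>m n" and a: "a \<noteq> 0"
  shows "Q * P = a \<cdot>\<^sub>m 1\<^sub>m n"
proof -
  interpret F: inj_comm_ring_hom "to_fract :: 'r \<Rightarrow> 'r fract" by (rule to_fract_inj_ring_hom)
  let ?P = "map_mat to_fract P" and ?Q = "map_mat to_fract Q"
  have P': "?P \<in> carrier_mat n n" and Q': "?Q \<in> carrier_mat n n" using P Q by simp_all
  define B where "B = inverse (to_fract a) \<cdot>\<^sub>m ?Q"
  have B: "B \<in> carrier_mat n n" using Q' by (simp add: B_def)
  have QB: "?Q = to_fract a \<cdot>\<^sub>m B" using a by (intro eq_matI) (auto simp: B_def)
  have "?P * ?Q = to_fract a \<cdot>\<^sub>m 1\<^sub>m n"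
    using P Q by (simp add: F.mat_hom_mult[symmetric] PQ F.map_mat_smult F.mat_hom_one)
  then have "?P * B = inverse (to_fract a) \<cdot>\<^sub>m (to_fract a \<cdot>\<^sub>m 1\<^sub>m n)"
    using mult_smult_distrib[OF P' Q'] by (simp add: B_def)
  also have "\<dots> = 1\<^sub>m n" using a by (intro eq_matI) auto
  finally have "B * ?P = 1\<^sub>m n"
    by (rule mat_mult_left_right_inverse[OF P' B])
  then have "?Q * ?P = to_fract a \<cdot>\<^sub>m 1\<^sub>m n"
    unfolding QB using mult_smult_assoc_mat[OF B P'] by simp
  then have "map_mat to_fract (Q * P) = map_mat to_fract (a \<cdot>\<^sub>m 1\<^sub>m n)"
    using P Q by (simp add: F.mat_hom_mult F.map_mat_smult F.mat_hom_one)
  then show ?thesis by (rule F.mat_hom_inj)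
qed

subsection \<open>Semilinear maps and coordinates\<close>

text \<open>The coefficients stay inside \<open>h\<close>, so one expansion serves maps that are
  linear, semilinear along \<sigma>, or semilinear along its inverse.\<close>

lemma additive_vec_expansion:
  fixes h :: "'r :: comm_ring_1 vec \<Rightarrow> 'm"
  assumes G: "abelian_group V"
    and clo: "\<And>v. v \<in> carrier_vec n \<Longrightarrow> h v \<in> carrier V"
    and add: "\<And>v w. \<lbrakk>v \<in> carrier_vec n; w \<in> carrier_vec n\<rbrakk> \<Longrightarrow> h (v + w) = h v \<oplus>\<^bsub>V\<^esub> h w"
    and v: "v \<in> carrier_vec n"
  shows "h v = (\<Oplus>\<^bsub>V\<^esub>i\<in>{..<n}. h (v $ i \<cdot>\<^sub>v unit_vec n i))"
proof -
  interpret V: abelian_group V by (rule G)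
  \<comment> \<open>Keeping only the first \<open>k\<close> entries lets the sum grow by one
    coordinate at each step of an induction on \<open>k\<close>.\<close>
  define trunc where "trunc k = vec n (\<lambda>i. if i < k then v $ i else 0)" for k
  have trunc: "trunc k \<in> carrier_vec n" for k by (simp add: trunc_def)
  have unit: "r \<cdot>\<^sub>v unit_vec n i \<in> carrier_vec n" for r :: 'r and i by simp
  have "h (trunc k) = (\<Oplus>\<^bsub>V\<^esub>i\<in>{..<k}. h (v $ i \<cdot>\<^sub>v unit_vec n i))" if "k \<le> n" for k
    using that
  proof (induction k)
    case 0
    \<comment> \<open>An additive map sends 0 to 0, by cancellation; this matches the empty
      sum.\<close>
    have "trunc 0 + trunc 0 = trunc 0" by (auto simp: trunc_def)
    then have "h (trunc 0) \<oplus>\<^bsub>V\<^esub> h (trunc 0) = h (trunc 0)"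
      using add[OF trunc[of 0] trunc[of 0]] by simp
    then show ?case
      using V.add.r_cancel_one[of "h (trunc 0)" "h (trunc 0)"] clo[OF trunc] by simp
  next
    case (Suc k)
    have "trunc (Suc k) = v $ k \<cdot>\<^sub>v unit_vec n k + trunc k"
      using Suc.prems by (intro eq_vecI) (auto simp: trunc_def unit_vec_def less_Suc_eq)
    then show ?case
      using Suc V.finsum_insert[of "{..<k}" k "\<lambda>i. h (v $ i \<cdot>\<^sub>v unit_vec n i)"] 
      by (simp add: add trunc clo Pi_def lessThan_Suc)
  qed
  moreover have "trunc n = v" using v by (auto simp: trunc_def)
  ultimately show ?thesis by auto
qed

text \<open>The columns of the matrix are the images of the unit vectors. Both sides are additive
  and semilinear, and \<tau> fixes the entries 0 and 1 of a unit vector, so they agree on every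
  multiple of a unit vector.\<close>

lemma semilinear_mat:
  fixes T :: "'r :: comm_ring_1 vec \<Rightarrow> 'r vec"
  assumes \<tau>: "comm_ring_hom \<tau>"
    and clo: "\<And>v. v \<in> carrier_vec n \<Longrightarrow> T v \<in> carrier_vec n"
    and add: "\<And>v w. \<lbrakk>v \<in> carrier_vec n; w \<in> carrier_vec n\<rbrakk> \<Longrightarrow> T (v + w) = T v + T w"
    and smult: "\<And>r v. v \<in> carrier_vec n \<Longrightarrow> T (r \<cdot>\<^sub>v v) = \<tau> r \<cdot>\<^sub>v T v"
  obtains P where "P \<in> carrier_mat n n" "\<And>v. v \<in> carrier_vec n \<Longrightarrow> T v = P *\<^sub>v map_vec \<tau> v"
proof
  interpret \<tau>: comm_ring_hom \<tau> by (rule \<tau>)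
  interpret V: vec_module "TYPE('r)" n .
  define P where "P = mat_of_cols n (map (\<lambda>i. T (unit_vec n i)) [0..<n])"
  show P: "P \<in> carrier_mat n n" by (simp add: P_def mat_of_cols_def)
  have G: "abelian_group (module_vec TYPE('r) n)" by (rule V.abelian_group_axioms)
  have smult': "P *\<^sub>v map_vec \<tau> (r \<cdot>\<^sub>v v) = \<tau> r \<cdot>\<^sub>v (P *\<^sub>v map_vec \<tau> v)" if "v \<in> carrier_vec n" for r v
    using P that by (simp add: \<tau>.vec_hom_smult mult_mat_smult_vec)
  have unit: "T (unit_vec n i) = P *\<^sub>v map_vec \<tau> (unit_vec n i)" if "i < n" for i
  proof -
    have "map_vec \<tau> (unit_vec n i) = unit_vec n i" by (auto simp: unit_vec_def)
    moreover have "P *\<^sub>v unit_vec n i = col P i"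
      using P that by (intro eq_vecI) simp_all
    moreover have "col P i = T (unit_vec n i)"
      using that clo by (simp add: P_def)
    ultimately show ?thesis by simp
  qed
  fix v :: "'r vec" assume v: "v \<in> carrier_vec n"
  let ?M = "module_vec TYPE('r) n"
  have "T v = (\<Oplus>\<^bsub>?M\<^esub>i\<in>{..<n}. T (v $ i \<cdot>\<^sub>v unit_vec n i))"
    using clo add v by (intro additive_vec_expansion G) (simp_all add: module_vec_def)
  also have "\<dots> = (\<Oplus>\<^bsub>?M\<^esub>i\<in>{..<n}. P *\<^sub>v map_vec \<tau> (v $ i \<cdot>\<^sub>v unit_vec n i))"
    using P by (intro V.finsum_cong') (auto simp: smult smult' unit module_vec_def)
  also have "\<dots> = P *\<^sub>v map_vec \<tau> v"
    using P v by (intro additive_vec_expansion[symmetric] G)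
      (simp_all add: module_vec_def mult_add_distrib_mat_vec[of _ n n] \<tau>.map_vec_add[of _ n])
  finally show "T v = P *\<^sub>v map_vec \<tau> v" .
qed

text \<open>An ordered basis in the form of a linear bijection from R^n. Matrices need the order,
  which the set in \<open>free_of_rank\<close> does not carry.\<close>

definition linear_coords :: "('r :: comm_ring_1, 'm) module \<Rightarrow> nat \<Rightarrow> ('r vec \<Rightarrow> 'm) \<Rightarrow> bool" where
  "linear_coords V n \<phi> \<longleftrightarrow> bij_betw \<phi> (carrier_vec n) (carrier V) \<and>
     (\<forall>v \<in> carrier_vec n. \<forall>w \<in> carrier_vec n. \<phi> (v + w) = \<phi> v \<oplus>\<^bsub>V\<^esub> \<phi> w) \<and>
     (\<forall>r. \<forall>v \<in> carrier_vec n. \<phi> (r \<cdot>\<^sub>v v) = r \<odot>\<^bsub>V\<^esub> \<phi> v)"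

text \<open>An enumeration of the basis turns coefficient vectors into linear combinations; spanning
  then means surjectivity, and independence means injectivity.\<close>

lemma free_of_rank_coords:
  fixes V :: "('r :: comm_ring_1, 'm) module"
  assumes "free_of_rank V n"
  obtains \<phi> where "linear_coords V n \<phi>"
proof -
  from assms obtain B where mod: "Module.module class_ring V" and B: "B \<subseteq> carrier V" "finite B" "card B = n"
    and indpt: "\<not> LinearCombinations.module.lin_dep class_ring V B"
    and span: "LinearCombinations.module.span class_ring V B = carrier V"
    by (auto simp: free_of_rank_def)
  interpret V: Module.module class_ring V by (rule mod)
  obtain b where b: "bij_betw b {..<n} B"
    using ex_bij_betw_nat_finite[OF B(2)] B(3) by (auto simp: lessThan_atLeast0)
  have bV: "b i \<in> carrier V" if "i < n" for i
    using b that B(1) by (auto simp: bij_betw_def)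
  have sV: "r \<odot>\<^bsub>V\<^esub> b i \<in> carrier V" if "i < n" for r i
    using V.smult_closed[of r "b i"] bV[OF that] by simp
  define \<phi> where "\<phi> c = (\<Oplus>\<^bsub>V\<^esub>i\<in>{..<n}. c $ i \<odot>\<^bsub>V\<^esub> b i)" for c
  have clo: "\<phi> c \<in> carrier V" for c
    unfolding \<phi>_def using sV by (intro V.finsum_closed) auto
  have add: "\<phi> (v + w) = \<phi> v \<oplus>\<^bsub>V\<^esub> \<phi> w" if "v \<in> carrier_vec n" "w \<in> carrier_vec n" for v w
  proof -
    have "\<phi> (v + w) = (\<Oplus>\<^bsub>V\<^esub>i\<in>{..<n}. v $ i \<odot>\<^bsub>V\<^esub> b i \<oplus>\<^bsub>V\<^esub> w $ i \<odot>\<^bsub>V\<^esub> b i)"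
      unfolding \<phi>_def using that sV bV V.smult_l_distr
      by (intro V.finsum_cong') auto
    also have "\<dots> = \<phi> v \<oplus>\<^bsub>V\<^esub> \<phi> w"
      unfolding \<phi>_def using sV by (intro V.finsum_addf) auto
    finally show ?thesis .
  qed
  have smult: "\<phi> (r \<cdot>\<^sub>v v) = r \<odot>\<^bsub>V\<^esub> \<phi> v" if "v \<in> carrier_vec n" for r v
  proof -
    have "\<phi> (r \<cdot>\<^sub>v v) = (\<Oplus>\<^bsub>V\<^esub>i\<in>{..<n}. r \<odot>\<^bsub>V\<^esub> (v $ i \<odot>\<^bsub>V\<^esub> b i))"
      unfolding \<phi>_def using that sV bV V.smult_assoc1
      by (intro V.finsum_cong') auto
    also have "\<dots> = r \<odot>\<^bsub>V\<^esub> \<phi> v"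
      unfolding \<phi>_def using sV by (intro V.finsum_smult_ldistr[symmetric]) auto
    finally show ?thesis .
  qed
  have lincomb: "V.lincomb c B = \<phi> (vec n (\<lambda>i. c (b i)))" for c
  proof -
    have "V.lincomb c B = (\<Oplus>\<^bsub>V\<^esub>x\<in>b ` {..<n}. c x \<odot>\<^bsub>V\<^esub> x)"
      using b by (simp add: V.lincomb_def bij_betw_def)
    also have "\<dots> = (\<Oplus>\<^bsub>V\<^esub>i\<in>{..<n}. c (b i) \<odot>\<^bsub>V\<^esub> b i)"
      using b sV by (intro V.finsum_reindex) (auto simp: bij_betw_def)
    also have "\<dots> = \<phi> (vec n (\<lambda>i. c (b i)))"
      unfolding \<phi>_def using sV by (intro V.finsum_cong') auto
    finally show ?thesis .
  qed
  have "bij_betw \<phi> (carrier_vec n) (carrier V)"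
    unfolding bij_betw_def
  proof
    show "inj_on \<phi> (carrier_vec n)"
    proof (rule inj_onI)
      fix v w :: "'r vec" assume v: "v \<in> carrier_vec n" and w: "w \<in> carrier_vec n" and eq: "\<phi> v = \<phi> w"
      have vw: "v - w \<in> carrier_vec n" using v w by simp
      have "v - w + w = v" using v w by (intro eq_vecI) auto
      then have "\<phi> (v - w) \<oplus>\<^bsub>V\<^esub> \<phi> w = \<phi> w"
        using add[OF vw w] eq by simp
      then have 0: "\<phi> (v - w) = \<zero>\<^bsub>V\<^esub>"
        using V.add.r_cancel_one[OF clo clo] by blast
      \<comment> \<open>Vectors are indexed by numbers and \<open>lincomb\<close> by basis elements;
        the inverse of the enumeration translates.\<close>
      let ?c = "\<lambda>x. (v - w) $ the_inv_into {..<n} b x"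
      have "vec n (\<lambda>i. ?c (b i)) = v - w"
        using b vw v w by (intro eq_vecI) (auto simp: bij_betw_def the_inv_into_f_f)
      then have lc: "V.lincomb ?c B = \<zero>\<^bsub>V\<^esub>" by (simp add: lincomb 0)
      have c: "?c x = 0" if "x \<in> B" for x
        using indpt V.lin_dep_crit[OF B(2) order_refl, of ?c x] that lc by auto
      show "v = w"
      proof (rule eq_vecI)
        fix i assume "i < dim_vec w"
        then have i: "i < n" using w by simp
        then have "b i \<in> B" using b by (auto simp: bij_betw_def)
        then show "v $ i = w $ i"
          using c[of "b i"] i b v w by (simp add: bij_betw_def the_inv_into_f_f)
      qed (use v w in auto)
    qed
    show "\<phi> ` carrier_vec n = carrier V"
    proof
      show "carrier V \<subseteq> \<phi> ` carrier_vec n"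
      proof
        fix x assume "x \<in> carrier V"
        then obtain c where "V.lincomb c B = x"
          using V.finite_in_span[OF B(2,1)] span by auto
        then show "x \<in> \<phi> ` carrier_vec n"
          unfolding lincomb by auto
      qed
    qed (use clo in auto)
  qed
  then have "linear_coords V n \<phi>"
    using add smult by (simp add: linear_coords_def)
  then show ?thesis by (rule that)
qed

lemma coords_free_of_rank:
  fixes V :: "('r :: comm_ring_1, 'm) module"
  assumes mod: "Module.module class_ring V" and \<phi>: "linear_coords V n \<phi>"
  shows "free_of_rank V n"
proof -
  interpret V: Module.module class_ring V by (rule mod)
  have bij: "bij_betw \<phi> (carrier_vec n) (carrier V)"
    and add: "\<And>v w. \<lbrakk>v \<in> carrier_vec n; w \<in> carrier_vec n\<rbrakk> \<Longrightarrow> \<phi> (v + w) = \<phi> v \<oplus>\<^bsub>V\<^esub> \<phi> w"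
    and smult: "\<And>r v. v \<in> carrier_vec n \<Longrightarrow> \<phi> (r \<cdot>\<^sub>v v) = r \<odot>\<^bsub>V\<^esub> \<phi> v"
    using \<phi> by (auto simp: linear_coords_def)
  have clo: "\<phi> v \<in> carrier V" if "v \<in> carrier_vec n" for v
    using bij that by (auto simp: bij_betw_def)
  define b where "b i = \<phi> (unit_vec n i)" for i
  define B where "B = b ` {..<n}"
  have inj: "inj_on b {..<n}"
  proof (rule inj_onI)
    fix i j assume ij: "i \<in> {..<n}" "j \<in> {..<n}" "b i = b j"
    then have eq: "unit_vec n i = (unit_vec n j :: 'r vec)"
      using bij unfolding b_def bij_betw_def by (meson inj_onD unit_vec_carrier)
    show "i = j"
      \<comment> \<open>Entry \<open>i\<close> is 1 on the left and, for distinct indices, 0 on the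
        right. The basis thus has exactly \<open>n\<close> elements.\<close>
      using arg_cong[OF eq, of "\<lambda>x. x $ i"] ij by (auto split: if_splits)
  qed
  have bV: "b i \<in> carrier V" for i
    by (simp add: b_def clo)
  have sV: "r \<odot>\<^bsub>V\<^esub> b i \<in> carrier V" for r i
    using V.smult_closed[of r "b i"] bV by simp
  have B: "B \<subseteq> carrier V" "finite B" "card B = n"
    using bV inj by (auto simp: B_def card_image)
  have expand: "\<phi> v = (\<Oplus>\<^bsub>V\<^esub>i\<in>{..<n}. v $ i \<odot>\<^bsub>V\<^esub> b i)" if "v \<in> carrier_vec n" for v
  proof -
    have "\<phi> v = (\<Oplus>\<^bsub>V\<^esub>i\<in>{..<n}. \<phi> (v $ i \<cdot>\<^sub>v unit_vec n i))"
      by (intro additive_vec_expansion V.abelian_group_axioms clo add that)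
    then show ?thesis by (simp add: smult b_def)
  qed
  have lincomb: "V.lincomb c B = \<phi> (vec n (\<lambda>i. c (b i)))" for c
  proof -
    have "V.lincomb c B = (\<Oplus>\<^bsub>V\<^esub>i\<in>{..<n}. c (b i) \<odot>\<^bsub>V\<^esub> b i)"
      unfolding V.lincomb_def B_def using inj sV by (intro V.finsum_reindex) auto
    also have "\<dots> = (\<Oplus>\<^bsub>V\<^esub>i\<in>{..<n}. vec n (\<lambda>i. c (b i)) $ i \<odot>\<^bsub>V\<^esub> b i)"
      using sV by (intro V.finsum_cong') auto
    finally show ?thesis by (simp add: expand)
  qed
  have "\<not> V.lin_dep B"
  proof (rule V.finite_lin_indpt2[OF B(2,1)])
    fix c :: "'m \<Rightarrow> 'r" assume "V.lincomb c B = \<zero>\<^bsub>V\<^esub>"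
    moreover have "\<phi> (0\<^sub>v n) = \<zero>\<^bsub>V\<^esub>"
      using add[of "0\<^sub>v n" "0\<^sub>v n"] V.add.r_cancel_one[OF clo clo, of "0\<^sub>v n" "0\<^sub>v n"] by simp
    ultimately have eq: "vec n (\<lambda>i. c (b i)) = 0\<^sub>v n"
      using bij unfolding bij_betw_def lincomb by (metis inj_onD vec_carrier zero_carrier_vec)
    have "c (b i) = 0" if "i < n" for i
      using arg_cong[OF eq, of "\<lambda>x. x $ i"] that by simp
    then show "\<forall>x\<in>B. c x = \<zero>\<^bsub>class_ring\<^esub>" by (auto simp: B_def)
  qed
  moreover have "V.span B = carrier V"
  proof
    show "V.span B \<subseteq> carrier V"
      unfolding V.finite_span[OF B(2,1)] by (auto simp: lincomb clo)
    show "carrier V \<subseteq> V.span B"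
    proof
      fix x assume "x \<in> carrier V"
      then obtain v where v: "v \<in> carrier_vec n" "x = \<phi> v"
        using bij by (auto simp: bij_betw_def)
      have "vec n (\<lambda>i. v $ the_inv_into {..<n} b (b i)) = v"
        using inj v by (intro eq_vecI) (auto simp: the_inv_into_f_f)
      then have "x = V.lincomb (\<lambda>x. v $ the_inv_into {..<n} b x) B"
        by (simp add: lincomb v)
      then show "x \<in> V.span B"
        unfolding V.finite_span[OF B(2,1)] by auto
    qed
  qed
  ultimately show ?thesis
    using mod B unfolding free_of_rank_def by blast
qed

subsection \<open>The modules \<open>V\<^sub>P\<close>\<close>

lemma comm_ring_hom_inv:
  assumes "comm_ring_hom \<sigma>" "bij \<sigma>"
  shows "comm_ring_hom (inv_into UNIV \<sigma>)"
proof -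
  interpret \<sigma>: comm_ring_hom \<sigma> by fact
  have s: "surj \<sigma>" and i: "inj \<sigma>" using assms(2) by (auto simp: bij_def)
  note f = surj_f_inv_f[OF s] and g = inv_f_f[OF i]
  show ?thesis
  proof
    show "inv_into UNIV \<sigma> 0 = 0" "inv_into UNIV \<sigma> 1 = 1"
      using g[of 0] g[of 1] by simp_all
    fix x y
    show "inv_into UNIV \<sigma> (x + y) = inv_into UNIV \<sigma> x + inv_into UNIV \<sigma> y"
      using g[of "inv_into UNIV \<sigma> x + inv_into UNIV \<sigma> y"] by (simp add: \<sigma>.hom_add f)
    show "inv_into UNIV \<sigma> (x * y) = inv_into UNIV \<sigma> x * inv_into UNIV \<sigma> y"
      using g[of "inv_into UNIV \<sigma> x * inv_into UNIV \<sigma> y"] by (simp add: \<sigma>.hom_mult f)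
  qed
qed

lemma map_vec_inv:
  assumes "bij \<sigma>"
  shows "map_vec \<sigma> (map_vec (inv_into UNIV \<sigma>) v) = v" "map_vec (inv_into UNIV \<sigma>) (map_vec \<sigma> v) = v"
  using assms by (auto simp: bij_def surj_f_inv_f)

text \<open>Here \<open>Q\<close> stands for a P^-1 before \<sigma> is applied to its entries, so
  that both product relations reduce to products of \<open>P\<close> and \<open>Q\<close>.\<close>

primrec gwa_mat_act ::
    "('r :: comm_ring_1 \<Rightarrow> 'r) \<Rightarrow> 'r mat \<Rightarrow> 'r mat \<Rightarrow> 'r gwa_gen \<Rightarrow> 'r vec \<Rightarrow> 'r vec" where
  "gwa_mat_act \<sigma> P Q (Scalar r) = (\<lambda>v. r \<cdot>\<^sub>v v)"
| "gwa_mat_act \<sigma> P Q X = (\<lambda>v. P *\<^sub>v map_vec (inv_into UNIV \<sigma>) v)"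
| "gwa_mat_act \<sigma> P Q Y = (\<lambda>v. map_mat \<sigma> Q *\<^sub>v map_vec \<sigma> v)"

lemma gwa_vec_action_mat:
  assumes \<sigma>: "comm_ring_hom \<sigma>" "bij \<sigma>" and P: "P \<in> carrier_mat n n" and Q: "Q \<in> carrier_mat n n"
    and PQ: "P * Q = a \<cdot>\<^sub>m 1\<^sub>m n" and QP: "Q * P = a \<cdot>\<^sub>m 1\<^sub>m n"
  shows "gwa_vec_action n (gwa_mat_act \<sigma> P Q) \<sigma> a"
proof -
  interpret \<sigma>: comm_ring_hom \<sigma> by fact
  interpret \<tau>: comm_ring_hom "inv_into UNIV \<sigma>" by (rule comm_ring_hom_inv[OF \<sigma>])
  have inv: "inv_into UNIV \<sigma> (\<sigma> r) = r" for r using \<sigma>(2) by (simp add: bij_def)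
  \<comment> \<open>With y v = \<sigma>(Q v), the inner \<sigma> and its inverse cancel: x y v = P Q
    v, and y x v is \<sigma> applied to Q P \<sigma>^-1(v).\<close>
  have Y: "map_mat \<sigma> Q *\<^sub>v map_vec \<sigma> v = map_vec \<sigma> (Q *\<^sub>v v)" if "v \<in> carrier_vec n" for v
    using \<sigma>.mult_mat_vec_hom[OF Q that] by simp
  have scal: "(a \<cdot>\<^sub>m 1\<^sub>m n) *\<^sub>v v = a \<cdot>\<^sub>v v" if "v \<in> carrier_vec n" for v
    using that by (intro eq_vecI) (auto simp: row_smult)
  have PQv: "P *\<^sub>v (Q *\<^sub>v v) = a \<cdot>\<^sub>v v" if "v \<in> carrier_vec n" for v
    using assoc_mult_mat_vec[OF P Q that] scal[OF that] by (simp add: PQ)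
  have QPv: "Q *\<^sub>v (P *\<^sub>v v) = a \<cdot>\<^sub>v v" if "v \<in> carrier_vec n" for v
    using assoc_mult_mat_vec[OF Q P that] scal[OF that] by (simp add: QP)
  show ?thesis
  proof
    fix v w :: "'a vec" and g :: "'a gwa_gen" and r :: 'a
    assume v: "v \<in> carrier_vec n"
    show "gwa_mat_act \<sigma> P Q g v \<in> carrier_vec n"
      using v P Q by (cases g) auto
    show "gwa_mat_act \<sigma> P Q (Scalar r) v = r \<cdot>\<^sub>v v" by simp
    show "gwa_mat_act \<sigma> P Q X (\<sigma> r \<cdot>\<^sub>v v) = r \<cdot>\<^sub>v gwa_mat_act \<sigma> P Q X v"
      using v P by (simp add: \<tau>.vec_hom_smult inv mult_mat_smult_vec)
    show "gwa_mat_act \<sigma> P Q Y (r \<cdot>\<^sub>v v) = \<sigma> r \<cdot>\<^sub>v gwa_mat_act \<sigma> P Q Y v"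
      using v Q by (simp add: \<sigma>.vec_hom_smult mult_mat_smult_vec[of _ n n])
    show "gwa_mat_act \<sigma> P Q X (gwa_mat_act \<sigma> P Q Y v) = a \<cdot>\<^sub>v v"
      using v by (simp add: Y map_vec_inv \<sigma> PQv)
    show "gwa_mat_act \<sigma> P Q Y (gwa_mat_act \<sigma> P Q X v) = \<sigma> a \<cdot>\<^sub>v v"
      using v P Q by (simp add: Y[of "P *\<^sub>v _"] QPv \<sigma>.vec_hom_smult map_vec_inv \<sigma>)
    assume w: "w \<in> carrier_vec n"
    show "gwa_mat_act \<sigma> P Q g (v + w) = gwa_mat_act \<sigma> P Q g v + gwa_mat_act \<sigma> P Q g w"
      using v w P Q by (cases g) (auto simp: smult_add_distrib_vec[of _ n] \<sigma>.map_vec_add[of _ n]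
          \<tau>.map_vec_add[of _ n] mult_add_distrib_mat_vec[of _ n n])
  qed
qed

lemma ex_is_V:
  fixes a :: "'r :: idom"
  assumes \<sigma>: "comm_ring_hom \<sigma>" "bij \<sigma>" and a: "a \<noteq> 0"
    and adm: "admissible a n P"
  shows "\<exists>V. is_V \<sigma> a n P V"
proof -
  have P: "P \<in> carrier_mat n n" using adm by (simp add: admissible_def)
  obtain Q where Q: "Q \<in> carrier_mat n n" and PQ: "P * Q = a \<cdot>\<^sub>m 1\<^sub>m n"
    using adm by (rule admissible_factor)
  interpret gwa_vec_action n "gwa_mat_act \<sigma> P Q" \<sigma> a
    by (rule gwa_vec_action_mat[OF \<sigma> P Q PQ factor_commute[OF P Q PQ a]])
  have "is_V \<sigma> a n P vec_gwa_module"
    unfolding is_V_def using left_module_vec_gwa_module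
    by (simp add: vec_gwa_module_simps smult_gwa_elem factor_admissible(2)[OF P Q PQ a])
  then show ?thesis by blast
qed

section \<open>Rank, uniqueness of the action and classification\<close>

lemma module_restrict_scalars:
  assumes "left_module (gwa \<sigma> a) M"
  shows "Module.module class_ring (restrict_scalars \<sigma> a M)"
proof -
  interpret M: left_module "gwa \<sigma> a" M by fact
  have grp: "abelian_group (restrict_scalars \<sigma> a M)"
    by (rule abelian_groupI)
      (auto simp: restrict_scalars_def M.M.a_ac intro: M.M.l_neg)
  show ?thesis
    unfolding Module.module_def module_axioms_def
    using grp class_cring.cring_axioms
    \<comment> \<open>The first three relations say that R maps to the algebra by a unital ring
      homomorphism; the scalar axioms follow from this.\<close>
    by (auto simp: restrict_scalars_def gwa_elem_relations(1-3) M.smult_l_distr M.smult_r_distr M.smult_assoc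
      M.smult_one M.smult_closed gwa_elem_in_carrier)
qed

lemma is_V_smult_gwa_elem:
  assumes "is_V \<sigma> a n P V" "v \<in> carrier_vec n"
  shows "gwa_elem \<sigma> a (Scalar r) \<odot>\<^bsub>V\<^esub> v = r \<cdot>\<^sub>v v"
    "gwa_elem \<sigma> a X \<odot>\<^bsub>V\<^esub> v = P *\<^sub>v map_vec (inv_into UNIV \<sigma>) v"
    "gwa_elem \<sigma> a Y \<odot>\<^bsub>V\<^esub> v = Q_mat \<sigma> a P *\<^sub>v map_vec \<sigma> v"
  using assms by (simp_all add: is_V_def)

lemma free_of_rank_is_V:
  assumes V: "is_V \<sigma> a n P V"
  shows "free_of_rank (restrict_scalars \<sigma> a V) n"
proof (rule coords_free_of_rank)
  show "Module.module class_ring (restrict_scalars \<sigma> a V)"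
    using V by (intro module_restrict_scalars) (simp add: is_V_def)
  show "linear_coords (restrict_scalars \<sigma> a V) n (\<lambda>v. v)"
    using V by (auto simp: linear_coords_def restrict_scalars_def is_V_def bij_betw_def)
qed

text \<open>The identity commutes with all generators, hence is linear over the whole algebra. This
  justifies speaking of the module V_P although \<open>is_V\<close> only prescribes
  generators.\<close>

lemma is_V_unique:
  assumes V: "is_V \<sigma> a n P V" and W: "is_V \<sigma> a n P W"
    and c: "c \<in> carrier (gwa \<sigma> a)" and v: "v \<in> carrier_vec n"
  shows "c \<odot>\<^bsub>V\<^esub> v = c \<odot>\<^bsub>W\<^esub> v"
proof -
  have "gwa_elem \<sigma> a g \<odot>\<^bsub>V\<^esub> v = gwa_elem \<sigma> a g \<odot>\<^bsub>W\<^esub> v" if "v \<in> carrier_vec n" for g v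
    using is_V_smult_gwa_elem[OF V that] is_V_smult_gwa_elem[OF W that] by (cases g) auto
  moreover have "left_module (gwa \<sigma> a) V" "left_module (gwa \<sigma> a) W"
    "carrier V = carrier_vec n" "carrier W = carrier_vec n"
    "\<And>v w. \<lbrakk>v \<in> carrier_vec n; w \<in> carrier_vec n\<rbrakk> \<Longrightarrow> v \<oplus>\<^bsub>V\<^esub> w = v \<oplus>\<^bsub>W\<^esub> w"
    using V W by (simp_all add: is_V_def)
  ultimately show ?thesis
    using gwa_linearI[of \<sigma> a V W "\<lambda>v. v" c v] c v by simp
qed

lemma free_module_isomorphic_V:
  fixes a :: "'r :: idom" and M :: "('r gwa_free set, 'm) module"
  assumes \<sigma>: "comm_ring_hom \<sigma>" "bij \<sigma>" and a: "a \<noteq> 0"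
    and M: "left_module (gwa \<sigma> a) M" and free: "free_of_rank (restrict_scalars \<sigma> a M) n"
  shows "\<exists>P V. admissible a n P \<and> is_V \<sigma> a n P V \<and> module_isomorphic (gwa \<sigma> a) M V"
proof -
  interpret \<sigma>: comm_ring_hom \<sigma> by fact
  interpret M: left_module "gwa \<sigma> a" M by fact
  let ?A = "gwa \<sigma> a" and ?e = "gwa_elem \<sigma> a"
  note e [simp] = gwa_elem_in_carrier[of \<sigma> a]
  have inv: "\<sigma> (inv_into UNIV \<sigma> r) = r" "inv_into UNIV \<sigma> (\<sigma> r) = r" for r
    using \<sigma>(2) by (simp_all add: bij_def surj_f_inv_f)
  obtain \<phi> where "linear_coords (restrict_scalars \<sigma> a M) n \<phi>"
    using free by (rule free_of_rank_coords)
  then have bij: "bij_betw \<phi> (carrier_vec n) (carrier M)"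
    and add: "\<And>v w. \<lbrakk>v \<in> carrier_vec n; w \<in> carrier_vec n\<rbrakk> \<Longrightarrow> \<phi> (v + w) = \<phi> v \<oplus>\<^bsub>M\<^esub> \<phi> w"
    and smult: "\<And>r v. v \<in> carrier_vec n \<Longrightarrow> \<phi> (r \<cdot>\<^sub>v v) = ?e (Scalar r) \<odot>\<^bsub>M\<^esub> \<phi> v"
    by (auto simp: linear_coords_def restrict_scalars_def)
  define \<psi> where "\<psi> = inv_into (carrier_vec n) \<phi>"
  have bij': "bij_betw \<psi> (carrier M) (carrier_vec n)"
    unfolding \<psi>_def by (rule bij_betw_inv_into[OF bij])
  have \<phi>_clo [simp]: "\<phi> v \<in> carrier M" if "v \<in> carrier_vec n" for v
    using bij that by (auto simp: bij_betw_def)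
  have \<psi>_clo [simp]: "\<psi> x \<in> carrier_vec n" if "x \<in> carrier M" for x
    using bij' that by (auto simp: bij_betw_def)
  have \<psi>\<phi> [simp]: "\<psi> (\<phi> v) = v" if "v \<in> carrier_vec n" for v
    unfolding \<psi>_def by (rule bij_betw_inv_into_left[OF bij that])
  have \<phi>\<psi> [simp]: "\<phi> (\<psi> x) = x" if "x \<in> carrier M" for x
    unfolding \<psi>_def by (rule bij_betw_inv_into_right[OF bij that])
  have \<psi>_add: "\<psi> (x \<oplus>\<^bsub>M\<^esub> y) = \<psi> x + \<psi> y" if "x \<in> carrier M" "y \<in> carrier M" for x y
    using \<psi>\<phi>[of "\<psi> x + \<psi> y"] that by (simp add: add)
  have \<psi>_smult: "\<psi> (?e (Scalar r) \<odot>\<^bsub>M\<^esub> x) = r \<cdot>\<^sub>v \<psi> x" if "x \<in> carrier M" for r x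
    using \<psi>\<phi>[of "r \<cdot>\<^sub>v \<psi> x"] that by (simp add: smult)
  \<comment> \<open>The action of each generator, transported to R^n along the coordinates.\<close>
  define T where "T g v = \<psi> (?e g \<odot>\<^bsub>M\<^esub> \<phi> v)" for g v
  have T_clo: "T g v \<in> carrier_vec n" if "v \<in> carrier_vec n" for g v
    using that by (simp add: T_def M.smult_closed)
  have T_add: "T g (v + w) = T g v + T g w" if "v \<in> carrier_vec n" "w \<in> carrier_vec n" for g v w
    using that by (simp add: T_def add M.smult_r_distr M.smult_closed \<psi>_add)
  have X_smult: "T X (r \<cdot>\<^sub>v v) = inv_into UNIV \<sigma> r \<cdot>\<^sub>v T X v" if v: "v \<in> carrier_vec n" for r v
  proof -
    \<comment> \<open>The relation x \<sigma>(s) = s x is taken at s = \<sigma>^-1(r), which makes x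
      semilinear along the inverse of \<sigma>.\<close>
    have "?e X \<odot>\<^bsub>M\<^esub> (?e (Scalar r) \<odot>\<^bsub>M\<^esub> \<phi> v) = ?e (Scalar (inv_into UNIV \<sigma> r)) \<odot>\<^bsub>M\<^esub> (?e X \<odot>\<^bsub>M\<^esub> \<phi> v)"
      using gwa_elem_relations(4)[where \<sigma> = \<sigma> and a = a and r = "inv_into UNIV \<sigma> r"] v
      by (simp add: M.smult_assoc[symmetric] inv)
    then show ?thesis using v by (simp add: T_def smult \<psi>_smult M.smult_closed)
  qed
  have Y_smult: "T Y (r \<cdot>\<^sub>v v) = \<sigma> r \<cdot>\<^sub>v T Y v" if v: "v \<in> carrier_vec n" for r v
  proof -
    have "?e Y \<odot>\<^bsub>M\<^esub> (?e (Scalar r) \<odot>\<^bsub>M\<^esub> \<phi> v) = ?e (Scalar (\<sigma> r)) \<odot>\<^bsub>M\<^esub> (?e Y \<odot>\<^bsub>M\<^esub> \<phi> v)"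
      using gwa_elem_relations(5)[where \<sigma> = \<sigma> and a = a and r = r] v
      by (simp add: M.smult_assoc[symmetric])
    then show ?thesis using v by (simp add: T_def smult \<psi>_smult M.smult_closed)
  qed
  have XY: "T X (T Y v) = a \<cdot>\<^sub>v v" if v: "v \<in> carrier_vec n" for v
    using v by (simp add: T_def M.smult_closed M.smult_assoc[symmetric] gwa_elem_relations(6) \<psi>_smult)
  obtain P where P: "P \<in> carrier_mat n n"
      and TX: "\<And>v. v \<in> carrier_vec n \<Longrightarrow> T X v = P *\<^sub>v map_vec (inv_into UNIV \<sigma>) v"
    using semilinear_mat[OF comm_ring_hom_inv[OF \<sigma>], of n "T X"] T_clo T_add X_smult by blast
  obtain Q' where Q': "Q' \<in> carrier_mat n n"
      and TY: "\<And>v. v \<in> carrier_vec n \<Longrightarrow> T Y v = Q' *\<^sub>v map_vec \<sigma> v"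
    using semilinear_mat[OF \<sigma>(1), of n "T Y"] T_clo T_add Y_smult by blast
  \<comment> \<open>Undoing \<sigma> on the matrix of y gives the candidate for a P^-1.\<close>
  define Q where "Q = map_mat (inv_into UNIV \<sigma>) Q'"
  have Q: "Q \<in> carrier_mat n n" using Q' by (simp add: Q_def)
  have Q'_eq: "Q' = map_mat \<sigma> Q" by (auto simp: Q_def inv)
  have PQ: "P * Q = a \<cdot>\<^sub>m 1\<^sub>m n"
  proof (rule eq_matI)
    fix i j assume "i < dim_row (a \<cdot>\<^sub>m 1\<^sub>m n)" "j < dim_col (a \<cdot>\<^sub>m 1\<^sub>m n)"
    then have ij: "i < n" "j < n" by auto
    let ?u = "unit_vec n j :: 'r vec"
    \<comment> \<open>Applying x to this vector cancels \<sigma> and leaves column \<open>j\<close>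
      of P Q, while the relation xy = a makes it \<open>a\<close> times a unit vector.\<close>
    have "T Y ?u = map_vec \<sigma> (Q *\<^sub>v ?u)"
      using \<sigma>.mult_mat_vec_hom[OF Q, of ?u] by (simp add: TY Q'_eq)
    then have "P *\<^sub>v (Q *\<^sub>v ?u) = a \<cdot>\<^sub>v ?u"
      using XY[of ?u] TX[of "T Y ?u"] T_clo[of ?u Y] by (simp add: map_vec_inv \<sigma>)
    then have "(P * Q) *\<^sub>v ?u = a \<cdot>\<^sub>v ?u"
      using assoc_mult_mat_vec[OF P Q, of ?u] by simp
    moreover have "A $$ (i, j) = (A *\<^sub>v ?u) $ i" if "A \<in> carrier_mat n n" for A
      using that ij by simp
    ultimately have "(P * Q) $$ (i, j) = (a \<cdot>\<^sub>v ?u) $ i"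
      using P Q by (metis mult_carrier_mat)
    then show "(P * Q) $$ (i, j) = (a \<cdot>\<^sub>m 1\<^sub>m n) $$ (i, j)"
      using ij by (simp add: unit_vec_def)
  qed (use P Q in auto)
  have adm: "admissible a n P" and QP: "Q_mat \<sigma> a P = Q'"
    using factor_admissible[OF P Q PQ a] by (simp_all add: Q'_eq)
  obtain V where V: "is_V \<sigma> a n P V" using ex_is_V[OF \<sigma> a adm] by blast
  have V': "left_module ?A V" "carrier V = carrier_vec n"
    "\<And>v w. \<lbrakk>v \<in> carrier_vec n; w \<in> carrier_vec n\<rbrakk> \<Longrightarrow> v \<oplus>\<^bsub>V\<^esub> w = v + w"
    using V by (auto simp: is_V_def)
  \<comment> \<open>For y this depends on \<open>QP\<close>: the matrix that \<open>is_V\<close>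
    prescribes is the one read off from the action on \<open>M\<close>.\<close>
  have \<psi>_gen: "\<psi> (?e g \<odot>\<^bsub>M\<^esub> x) = ?e g \<odot>\<^bsub>V\<^esub> \<psi> x" if x: "x \<in> carrier M" for g x
  proof -
    have "\<psi> (?e g \<odot>\<^bsub>M\<^esub> x) = T g (\<psi> x)" using x by (simp add: T_def)
    then show ?thesis
      using x by (cases g) (simp_all add: is_V_smult_gwa_elem[OF V] TX TY QP \<psi>_smult)
  qed
  have "\<psi> (c \<odot>\<^bsub>M\<^esub> x) = c \<odot>\<^bsub>V\<^esub> \<psi> x" if "c \<in> carrier ?A" "x \<in> carrier M" for c x
    using that gwa_linearI[OF M V'(1), of \<psi> c x] by (simp add: V'(2,3) \<psi>_add \<psi>_gen)
  then have "\<psi> \<in> LinearCombinations.module_hom ?A M V"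
    by (auto simp: LinearCombinations.module_hom_def V'(2,3) \<psi>_add)
  then have "module_isomorphic ?A M V"
    using bij' unfolding module_isomorphic_def V'(2) by blast
  then show ?thesis using adm V by blast
qed

theorem proposition5p1:
  fixes \<sigma> :: "'r :: idom \<Rightarrow> 'r" and a :: 'r
  assumes "comm_ring_hom \<sigma>" and "bij \<sigma>" and "a \<noteq> 0"
  shows "(\<forall>n P. n \<ge> 1 \<longrightarrow> admissible a n P \<longrightarrow>
            (\<exists>V. is_V \<sigma> a n P V) \<and>
            (\<forall>V. is_V \<sigma> a n P V \<longrightarrow> free_of_rank (restrict_scalars \<sigma> a V) n) \<and>
            (\<forall>V W. is_V \<sigma> a n P V \<longrightarrow> is_V \<sigma> a n P W \<longrightarrow>
               (\<forall>c \<in> carrier (gwa \<sigma> a). \<forall>v \<in> carrier_vec n. c \<odot>\<^bsub>V\<^esub> v = c \<odot>\<^bsub>W\<^esub> v)))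
       \<and> (\<forall>(M :: ('r gwa_free set, 'm) module) n.
            left_module (gwa \<sigma> a) M \<longrightarrow> free_of_rank (restrict_scalars \<sigma> a M) n \<longrightarrow>
            (\<exists>P V. admissible a n P \<and> is_V \<sigma> a n P V \<and> module_isomorphic (gwa \<sigma> a) M V))"
proof (intro conjI allI impI ballI)
  show "\<exists>V. is_V \<sigma> a n P V" if "admissible a n P" for n P
    by (rule ex_is_V[OF assms that])
  show "\<exists>P V. admissible a n P \<and> is_V \<sigma> a n P V \<and> module_isomorphic (gwa \<sigma> a) M V"
    if "left_module (gwa \<sigma> a) M" "free_of_rank (restrict_scalars \<sigma> a M) n"
    for M :: "('r gwa_free set, 'm) module" and n
    by (rule free_module_isomorphic_V[OF assms that])
qed (assumption | rule free_of_rank_is_V is_V_unique)+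

end
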